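(* Let $X$ be a non-empty finite set, let $C$ be a family of subsets of $X$ with $|C|\ge 2$, let $Z=X\times\{0,1\}$, and let $c\models(x,b)$ if and only if ($b=1$ and $x\in c$) or ($b=0$ and $x\notin c$). Then $$\mathrm{MAP\text{-}TD}^{\overline{O},\overline{R}}(C)=\mathrm{SMN}(G(C)^{\overline{O},\overline{R}})\quad\text{and}\quad\mathrm{MLE\text{-}TD}^{\overline{O},\overline{R}}(C)=\mathrm{SMN}(G(C)^{\overline{O},\overline{R}}_{\neq\emptyset}).$$
   Context: For $A\subseteq Z$, $c\models A$ means $c\models z$ for all $z\in A$. (Unordered sampling without replacement.) For a probability vector $Q=(q(z))_{z\in Z}$ and a set $A=\{z_1,\dots,z_n\}\subseteq Z$ of size $n\le|\{z:q(z)>0\}|$, $P^{\overline{O},\overline{R}}(A|Q)=\sum_\sigma\prod_{i=1}^n \frac{q(z_{\sigma(i)})}{1-(q(z_{\sigma(1)})+\dots+q(z_{\sigma(i-1)}))}$ over all permutations $\sigma$ of $\{1,\dots,n\}$ (equal to $1$ for $A=\emptyset$). A MAP-learner $L$ for $C$ is given by priors $P(c)>0$ with $\sum_{c\in C}P(c)=1$ and conditional likelihoods $P(z|c)\ge 0$ with $\sum_{z\in Z}P(z|c)=1$ for each $c\in C$, subject to: $c\not\models z$ implies $P(z|c)=0$. An MLE-learner is a MAP-learner with uniform priors. Let $N^+(C,L)=\min_{c\in C}|\{z\in Z:P(z|c)>0\}|$. A teacher for $L$ is a map $T:C\to 2^Z$ such that for every $c_0\in C$: $|T(c_0)|\le N^+(C,L)$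 and $c_0$ is the unique maximizer over $c\in C$ of $P(c)\cdot P^{\overline{O},\overline{R}}(T(c_0)|P(\cdot|c))$. Its order is $\max_{c\in C}|T(c)|$. $\mathrm{MAP\text{-}TD}^{\overline{O},\overline{R}}(C)$ (resp. $\mathrm{MLE\text{-}TD}^{\overline{O},\overline{R}}(C)$) is the smallest $d$ such that some MAP-learner (resp. MLE-learner) for $C$ has a teacher of order $d$. $G(C)^{\overline{O},\overline{R}}$ is the bipartite graph with vertex classes $C$ and $2^Z$ and edges $\{(c,A):c\models A\}$; $G(C)^{\overline{O},\overline{R}}_{\neq\emptyset}$ results from it by removing the vertex $\emptyset$ from the second class. A $C$-saturating matching is an injective map $M$ from $C$ to the second vertex class with $(c,M(c))$ an edge for each $c\in C$; its order is $\max_{c\in C}|M(c)|$. $\mathrm{SMN}(G)$ is the smallest possible order of a $C$-saturating matching in $G$. *)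

theory Defs
  imports "HOL-Library.Extended_Nat" "HOL-Combinatorics.Multiset_Permutations" Complex_Main
begin

(* Concepts are elements of C, examples are elements of Z, and "sat c z" is the consistency
   relation between a concept c and an example z. *)

definition sat_all :: "('c \<Rightarrow> 'z \<Rightarrow> bool) \<Rightarrow> 'c \<Rightarrow> 'z set \<Rightarrow> bool" where
  "sat_all sat c A \<longleftrightarrow> (\<forall>z\<in>A. sat c z)"

(* Unordered sampling without replacement. The sum over all permutations of the indices of
   A = {z_1, ..., z_n} is taken over the orderings of A, i.e. over the distinct lists with
   element set A; indices start at 0. Only meaningful when card A is at most the number of
   points of positive mass, which then makes all denominators positive. *)
definition unordered_prob :: "'z set \<Rightarrow> ('z \<Rightarrow> real) \<Rightarrow> real" where
  "unordered_prob A q =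
     (\<Sum>zs\<in>permutations_of_set A. \<Prod>i<length zs. q (zs ! i) / (1 - (\<Sum>j<i. q (zs ! j))))"

record ('c, 'z) learner =
  prior :: "'c \<Rightarrow> real"
  likelihood :: "'c \<Rightarrow> 'z \<Rightarrow> real"

definition MAP_learner ::
    "'c set \<Rightarrow> 'z set \<Rightarrow> ('c \<Rightarrow> 'z \<Rightarrow> bool) \<Rightarrow> ('c, 'z) learner \<Rightarrow> bool" where
  "MAP_learner C Z sat L \<longleftrightarrow>
     (\<forall>c\<in>C. prior L c > 0) \<and> (\<Sum>c\<in>C. prior L c) = 1 \<and>
     (\<forall>c\<in>C. (\<forall>z\<in>Z. likelihood L c z \<ge> 0) \<and> (\<Sum>z\<in>Z. likelihood L c z) = 1) \<and>
     (\<forall>c\<in>C. \<forall>z\<in>Z. \<not> sat c z \<longrightarrow> likelihood L c z = 0)"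

definition MLE_learner ::
    "'c set \<Rightarrow> 'z set \<Rightarrow> ('c \<Rightarrow> 'z \<Rightarrow> bool) \<Rightarrow> ('c, 'z) learner \<Rightarrow> bool" where
  "MLE_learner C Z sat L \<longleftrightarrow>
     MAP_learner C Z sat L \<and> (\<forall>c\<in>C. prior L c = 1 / real (card C))"

definition N_plus :: "'c set \<Rightarrow> 'z set \<Rightarrow> ('c, 'z) learner \<Rightarrow> nat" where
  "N_plus C Z L = Min ((\<lambda>c. card {z\<in>Z. likelihood L c z > 0}) ` C)"

definition teacher ::
    "'c set \<Rightarrow> 'z set \<Rightarrow> ('c, 'z) learner \<Rightarrow> ('c \<Rightarrow> 'z set) \<Rightarrow> bool" where
  "teacher C Z L T \<longleftrightarrow>
     (\<forall>c0\<in>C. T c0 \<subseteq> Z \<and> card (T c0) \<le> N_plus C Z L \<and>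
        {c. is_arg_max (\<lambda>c. prior L c * unordered_prob (T c0) (likelihood L c)) (\<lambda>c. c \<in> C) c}
          = {c0})"

(* The order of a teacher, and likewise of a matching, viewed as a map on C. *)
definition map_order :: "'c set \<Rightarrow> ('c \<Rightarrow> 'z set) \<Rightarrow> nat" where
  "map_order C M = Max ((\<lambda>c. card (M c)) ` C)"

(* Smallest possible orders are infima in enat: attained if a witness exists, infinite otherwise. *)

definition MAP_TD :: "'c set \<Rightarrow> 'z set \<Rightarrow> ('c \<Rightarrow> 'z \<Rightarrow> bool) \<Rightarrow> enat" where
  "MAP_TD C Z sat =
     Inf {enat d |d. \<exists>L T. MAP_learner C Z sat L \<and> teacher C Z L T \<and> map_order C T = d}"

definition MLE_TD :: "'c set \<Rightarrow> 'z set \<Rightarrow> ('c \<Rightarrow> 'z \<Rightarrow> bool) \<Rightarrow> enat" where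
  "MLE_TD C Z sat =
     Inf {enat d |d. \<exists>L T. MLE_learner C Z sat L \<and> teacher C Z L T \<and> map_order C T = d}"

record ('l, 'r) bigraph =
  left :: "'l set"
  right :: "'r set"
  edges :: "('l \<times> 'r) set"

definition consistency_graph ::
    "'c set \<Rightarrow> 'z set \<Rightarrow> ('c \<Rightarrow> 'z \<Rightarrow> bool) \<Rightarrow> ('c, 'z set) bigraph" where
  "consistency_graph C Z sat =
     \<lparr>left = C, right = Pow Z, edges = {(c, A). c \<in> C \<and> A \<in> Pow Z \<and> sat_all sat c A}\<rparr>"

definition remove_right :: "'r \<Rightarrow> ('l, 'r) bigraph \<Rightarrow> ('l, 'r) bigraph" where
  "remove_right v G =
     \<lparr>left = left G, right = right G - {v}, edges = {(l, r) \<in> edges G. r \<noteq> v}\<rparr>"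

definition saturating_matching :: "('l, 'r) bigraph \<Rightarrow> ('l \<Rightarrow> 'r) \<Rightarrow> bool" where
  "saturating_matching G M \<longleftrightarrow>
     M ` left G \<subseteq> right G \<and> inj_on M (left G) \<and> (\<forall>l\<in>left G. (l, M l) \<in> edges G)"

definition SMN :: "('c, 'z set) bigraph \<Rightarrow> enat" where
  "SMN G = Inf {enat d |d. \<exists>M. saturating_matching G M \<and> map_order (left G) M = d}"

definition labeled_examples :: "'a set \<Rightarrow> ('a \<times> nat) set" where
  "labeled_examples X = X \<times> {0, 1}"

definition label_sat :: "'a set \<Rightarrow> 'a \<times> nat \<Rightarrow> bool" where
  "label_sat c = (\<lambda>(x, b). (b = 1 \<and> x \<in> c) \<or> (b = 0 \<and> x \<notin> c))"

end

(* A teacher is itself a saturating matching: maximizers are unique, and a concept that assigns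
   probability 0 to its teaching set cannot be the unique maximizer. Conversely, a matching M is a
   teacher for the learner whose likelihood for c puts equal, dominating weights on M c and equal,
   small weights on the other examples consistent with c. Sampling then yields M c with probability
   at least 2/3. A nonempty set A = M c' for another concept c' has probability at most 1/2 under c:
   some element of A can be exchanged for one outside A that is at least as heavy, which gives a
   different set of the same size that is at least as likely. (If A contains M c, the new element
   exists because the set of all examples consistent with c determines c, so A is not that set.)
   The empty set has probability 1 under every concept, so the concept matched to it gets a prior
   larger by the factor 5/4. *)

theory Submission
  imports Defs "HOL-Analysis.Infinite_Products"
begin

section \<open>Unordered sampling without replacement\<close>

definition ordered_prob :: "'z list \<Rightarrow> ('z \<Rightarrow> real) \<Rightarrow> real" where
  "ordered_prob zs q = (\<Prod>i<length zs. q (zs ! i) / (1 - (\<Sum>j<i. q (zs ! j))))"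

lemma unordered_prob_altdef:
  "unordered_prob A q = (\<Sum>zs\<in>permutations_of_set A. ordered_prob zs q)"
  unfolding unordered_prob_def ordered_prob_def ..

lemma unordered_prob_empty [simp]: "unordered_prob {} q = 1"
  by (simp add: unordered_prob_def)

lemma sum_nth_distinct:
  assumes "distinct zs" "i \<le> length zs"
  shows "(\<Sum>j<i. q (zs ! j)) = sum q (set (take i zs))"
proof -
  have "(\<Sum>j<i. q (zs ! j)) = sum_list (map q (take i zs))"
    using assms(2) by (simp add: sum_list_sum_nth atLeast0LessThan)
  also have "\<dots> = sum q (set (take i zs))"
    using assms(1) by (simp add: sum_list_distinct_conv_sum_set)
  finally show ?thesis .
qed

text \<open>Bounds the denominators of \<open>ordered_prob\<close>: when \<open>sum q Z = 1\<close>,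
  each is at least its own numerator, so it is nonnegative, and positive if the numerator
  is.\<close>

lemma sum_nth_add_nth_le:
  fixes q :: "'z \<Rightarrow> real"
  assumes "finite Z" "\<forall>z\<in>Z. q z \<ge> 0" "distinct zs" "set zs \<subseteq> Z" "i < length zs"
  shows "(\<Sum>j<i. q (zs ! j)) + q (zs ! i) \<le> sum q Z"
proof -
  have "(\<Sum>j<i. q (zs ! j)) + q (zs ! i) = (\<Sum>j<Suc i. q (zs ! j))" by simp
  also have "\<dots> = sum q (set (take (Suc i) zs))"
    using assms by (intro sum_nth_distinct) auto
  also have "\<dots> \<le> sum q Z"
    using assms set_take_subset[of "Suc i" zs] by (intro sum_mono2) auto
  finally show ?thesis .
qed

lemma ordered_prob_nonneg:
  assumes "finite Z" "\<forall>z\<in>Z. q z \<ge> 0" "sum q Z = 1" "distinct zs" "set zs \<subseteq> Z"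
  shows "ordered_prob zs q \<ge> 0"
  unfolding ordered_prob_def
proof (intro prod_nonneg ballI divide_nonneg_nonneg)
  fix i assume "i \<in> {..<length zs}"
  then have i: "i < length zs" by simp
  then show q: "q (zs ! i) \<ge> 0" using assms(2,5) nth_mem by blast
  show "0 \<le> 1 - (\<Sum>j<i. q (zs ! j))"
    using sum_nth_add_nth_le[OF assms(1,2,4,5) i] assms(3) q by linarith
qed

lemma unordered_prob_nonneg:
  assumes "finite Z" "\<forall>z\<in>Z. q z \<ge> 0" "sum q Z = 1" "A \<subseteq> Z"
  shows "unordered_prob A q \<ge> 0"
  unfolding unordered_prob_altdef
  using assms by (auto intro!: sum_nonneg ordered_prob_nonneg[of Z] dest: permutations_of_setD)

lemma unordered_prob_eq_0:
  assumes "z \<in> A" "q z = 0"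
  shows "unordered_prob A q = 0"
  unfolding unordered_prob_altdef
proof (intro sum.neutral ballI)
  fix zs assume "zs \<in> permutations_of_set A"
  then have "z \<in> set zs" using assms(1) by (auto dest: permutations_of_setD)
  then obtain i where "i < length zs" "zs ! i = z" by (auto simp: in_set_conv_nth)
  then show "ordered_prob zs q = 0"
    unfolding ordered_prob_def using assms(2) by (intro prod_zero) auto
qed

section \<open>Total probability of the sequences of a fixed length\<close>

definition draws :: "'z set \<Rightarrow> nat \<Rightarrow> 'z list set" where
  "draws Z k = {zs. distinct zs \<and> set zs \<subseteq> Z \<and> length zs = k}"

lemma finite_draws: "finite Z \<Longrightarrow> finite (draws Z k)"
  unfolding draws_def
  by (rule finite_subset[OF _ finite_lists_length_eq[of Z k]]) auto

lemma draws_Suc: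
  "draws Z (Suc k) = (\<lambda>(zs, z). zs @ [z]) ` (SIGMA zs:draws Z k. Z - set zs)"
proof (intro equalityI subsetI)
  fix ys assume ys: "ys \<in> draws Z (Suc k)"
  then obtain zs z where zs: "ys = zs @ [z]"
    by (cases ys rule: rev_cases) (auto simp: draws_def)
  have "(zs, z) \<in> (SIGMA zs:draws Z k. Z - set zs)"
    using ys by (simp add: zs draws_def)
  then show "ys \<in> (\<lambda>(zs, z). zs @ [z]) ` (SIGMA zs:draws Z k. Z - set zs)"
    unfolding zs by (rule rev_image_eqI) simp
qed (auto simp: draws_def)

text \<open>Appending at the end leaves the earlier factors unchanged, and the new denominator
  depends only on the set of earlier elements. This feeds the induction on the number of
  draws.\<close>

lemma ordered_prob_snoc:
  assumes "distinct zs"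
  shows "ordered_prob (zs @ [z]) q = ordered_prob zs q * (q z / (1 - sum q (set zs)))"
proof -
  have "(\<Sum>j<length zs. q ((zs @ [z]) ! j)) = (\<Sum>j<length zs. q (zs ! j))"
    by (intro sum.cong) (auto simp: nth_append)
  also have "\<dots> = sum q (set zs)"
    using sum_nth_distinct[OF assms, of "length zs" q] by simp
  finally have last: "(\<Sum>j<length zs. q ((zs @ [z]) ! j)) = sum q (set zs)" .
  have "(\<Prod>i<length zs. q ((zs @ [z]) ! i) / (1 - (\<Sum>j<i. q ((zs @ [z]) ! j)))) = ordered_prob zs q"
    unfolding ordered_prob_def
    by (intro prod.cong refl arg_cong2[where f = "(/)"] arg_cong2[where f = "(-)"] sum.cong)
       (auto simp: nth_append)
  with last show ?thesis
    unfolding ordered_prob_def by simp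
qed

lemma sum_ordered_prob_draws_le_1:
  assumes "finite Z" "\<forall>z\<in>Z. q z \<ge> 0" "sum q Z = 1"
  shows "(\<Sum>zs\<in>draws Z k. ordered_prob zs q) \<le> 1"
proof (induction k)
  case 0
  have "draws Z 0 = {[]}" by (auto simp: draws_def)
  then show ?case by (simp add: ordered_prob_def)
next
  case (Suc k)
  have "(\<Sum>zs\<in>draws Z (Suc k). ordered_prob zs q) =
        (\<Sum>(zs, z)\<in>(SIGMA zs:draws Z k. Z - set zs). ordered_prob (zs @ [z]) q)"
    unfolding draws_Suc by (subst sum.reindex) (auto intro!: inj_onI simp: case_prod_unfold)
  also have "\<dots> = (\<Sum>zs\<in>draws Z k. \<Sum>z\<in>Z - set zs. ordered_prob (zs @ [z]) q)"
    using assms(1) by (intro sum.Sigma[symmetric] finite_draws) auto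
  also have "\<dots> \<le> (\<Sum>zs\<in>draws Z k. ordered_prob zs q)"
  proof (intro sum_mono)
    fix zs assume "zs \<in> draws Z k"
    then have zs: "distinct zs" "set zs \<subseteq> Z" by (auto simp: draws_def)
    have rest: "(\<Sum>z\<in>Z - set zs. q z) = 1 - sum q (set zs)"
      using assms zs by (simp add: sum_diff)
    have "(\<Sum>z\<in>Z - set zs. ordered_prob (zs @ [z]) q) =
          ordered_prob zs q * ((\<Sum>z\<in>Z - set zs. q z) / (1 - sum q (set zs)))"
      using zs by (simp add: ordered_prob_snoc sum_distrib_left sum_divide_distrib)
    \<comment> \<open>By \<open>rest\<close> numerator and denominator of the quotient agree: it is
      1, or 0 by division by zero once the prefix has used up all the mass. Hence an inequality
      instead of an equation.\<close>
    also have "\<dots> \<le> ordered_prob zs q * 1"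
      using ordered_prob_nonneg[OF assms zs] rest by (intro mult_left_mono) auto
    finally show "(\<Sum>z\<in>Z - set zs. ordered_prob (zs @ [z]) q) \<le> ordered_prob zs q" by simp
  qed
  finally show ?case using Suc.IH by linarith
qed

text \<open>Orderings of \<open>A\<close> and of \<open>B\<close> are different outcomes of the same
  number of draws, so they share a total probability of at most 1.\<close>

lemma unordered_prob_add_le_1:
  assumes "finite Z" "\<forall>z\<in>Z. q z \<ge> 0" "sum q Z = 1"
    and "A \<subseteq> Z" "B \<subseteq> Z" "A \<noteq> B" "card A = card B"
  shows "unordered_prob A q + unordered_prob B q \<le> 1"
proof -
  have sub: "permutations_of_set D \<subseteq> draws Z (card D)" if "D \<subseteq> Z" for D
    using that by (auto simp: draws_def permutations_of_set_def distinct_card)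
  have "unordered_prob A q + unordered_prob B q =
        (\<Sum>zs\<in>permutations_of_set A \<union> permutations_of_set B. ordered_prob zs q)"
    unfolding unordered_prob_altdef using assms(6)
    by (intro sum.union_disjoint[symmetric]) (auto dest: permutations_of_setD)
  also have "\<dots> \<le> (\<Sum>zs\<in>draws Z (card A). ordered_prob zs q)"
    using assms sub[of A] sub[of B] finite_draws[OF assms(1)]
    by (intro sum_mono2) (auto simp: draws_def intro!: ordered_prob_nonneg[OF assms(1-3)])
  also have "\<dots> \<le> 1" by (rule sum_ordered_prob_draws_le_1[OF assms(1-3)])
  finally show ?thesis .
qed

section \<open>Exchanging an element for a heavier one\<close>

text \<open>Heavier elements raise every numerator and every partial sum, hence lower every
  denominator. Positivity carries over to the images and keeps the new denominators positive, so no
  factor collapses to 0 through division by zero.\<close>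

lemma ordered_prob_map_mono:
  assumes "finite Z" "\<forall>z\<in>Z. q z \<ge> 0" "sum q Z = 1"
    and "distinct (map h zs)" "h ` set zs \<subseteq> Z"
    and pos: "\<forall>z\<in>set zs. q z > 0" and le: "\<forall>z\<in>set zs. q z \<le> q (h z)"
  shows "ordered_prob zs q \<le> ordered_prob (map h zs) q"
proof -
  have "ordered_prob zs q \<le>
        (\<Prod>i<length zs. q (map h zs ! i) / (1 - (\<Sum>j<i. q (map h zs ! j))))"
    unfolding ordered_prob_def
  proof (intro prod_mono conjI)
    fix i assume "i \<in> {..<length zs}"
    then have i: "i < length zs" by simp
    have num: "0 < q (zs ! i)" "q (zs ! i) \<le> q (map h zs ! i)"
      using i pos le by auto
    have sums: "(\<Sum>j<i. q (zs ! j)) \<le> (\<Sum>j<i. q (map h zs ! j))"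
      using i le by (intro sum_mono) auto
    have "(\<Sum>j<i. q (map h zs ! j)) + q (map h zs ! i) \<le> 1"
      using sum_nth_add_nth_le[OF assms(1,2,4), of i] assms(3,5) i by simp
    then have den: "0 < 1 - (\<Sum>j<i. q (map h zs ! j))"
      using num by linarith
    show "q (zs ! i) / (1 - (\<Sum>j<i. q (zs ! j))) \<le>
          q (map h zs ! i) / (1 - (\<Sum>j<i. q (map h zs ! j)))"
      using num den sums by (intro frac_le) linarith+
    show "0 \<le> q (zs ! i) / (1 - (\<Sum>j<i. q (zs ! j)))"
      using num den sums by (intro divide_nonneg_nonneg) linarith+
  qed
  then show ?thesis by (simp add: ordered_prob_def)
qed

text \<open>Relabeling \<open>z\<close> as \<open>z'\<close> maps the orderings of \<open>A\<close>
  bijectively to those of the new set and never lowers the probability of an ordering.\<close>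

lemma unordered_prob_exchange_mono:
  assumes "finite Z" "\<forall>z\<in>Z. q z \<ge> 0" "sum q Z = 1"
    and "A \<subseteq> Z" "z \<in> A" "z' \<in> Z - A" "q z \<le> q z'" "\<forall>y\<in>A. q y > 0"
  shows "unordered_prob A q \<le> unordered_prob (insert z' (A - {z})) q"
proof -
  define h where "h = (\<lambda>y. if y = z then z' else y)"
  have inj: "inj_on h A" using assms(6) by (auto simp: h_def inj_on_def)
  have img: "h ` A = insert z' (A - {z})" using assms(5) by (auto simp: h_def)
  have "unordered_prob A q \<le> (\<Sum>zs\<in>permutations_of_set A. ordered_prob (map h zs) q)"
    unfolding unordered_prob_altdef
  proof (intro sum_mono ordered_prob_map_mono[OF assms(1-3)])
    fix zs assume "zs \<in> permutations_of_set A"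
    then have zs: "set zs = A" "distinct zs" by (auto dest: permutations_of_setD)
    show "distinct (map h zs)" using zs inj by (simp add: distinct_map)
    show "h ` set zs \<subseteq> Z" using zs img assms by auto
    show "\<forall>y\<in>set zs. q y > 0" using zs assms by auto
    show "\<forall>y\<in>set zs. q y \<le> q (h y)" using assms by (auto simp: h_def)
  qed
  also have "\<dots> = (\<Sum>zs\<in>map h ` permutations_of_set A. ordered_prob zs q)"
  proof -
    have "inj_on (map h) (permutations_of_set A)"
      using inj by (intro inj_onI) (auto simp: permutations_of_set_def intro: map_inj_on)
    then show ?thesis by (simp add: sum.reindex)
  qed
  also have "map h ` permutations_of_set A = permutations_of_set (insert z' (A - {z}))"
    using permutations_of_set_image_inj[OF inj] img by simp
  finally show ?thesis by (simp add: unordered_prob_altdef)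
qed

text \<open>The exchanged set is different, equally large and at least as likely, and the two
  probabilities sum to at most 1. If \<open>A\<close> has an element of mass 0, its probability is 0
  anyway.\<close>

lemma unordered_prob_le_half:
  assumes "finite Z" "\<forall>z\<in>Z. q z \<ge> 0" "sum q Z = 1"
    and "A \<subseteq> Z" "z \<in> A" "z' \<in> Z - A" "q z \<le> q z'"
  shows "unordered_prob A q \<le> 1 / 2"
proof (cases "\<forall>y\<in>A. q y > 0")
  case True
  let ?B = "insert z' (A - {z})"
  have "finite A" using assms by (auto intro: finite_subset)
  then have "card ?B = card A" using assms card_Suc_Diff1[of A z] by simp
  then have "unordered_prob A q + unordered_prob ?B q \<le> 1"
    using assms by (intro unordered_prob_add_le_1[OF assms(1-3)]) auto
  with unordered_prob_exchange_mono[OF assms True] show ?thesis by linarith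
next
  case False
  then obtain y where "y \<in> A" "q y = 0" using assms(2,4) by fastforce
  then show ?thesis by (simp add: unordered_prob_eq_0)
qed

section \<open>Sets of equally likely elements\<close>

text \<open>All \<open>fact (card A)\<close> orderings are equally likely. Spreading the factorial
  over the product makes factor \<open>i\<close> the chance that the next draw stays in
  \<open>A\<close> after \<open>i\<close> draws from \<open>A\<close>.\<close>

lemma unordered_prob_uniform:
  assumes "finite A" "\<forall>z\<in>A. q z = w"
  shows "unordered_prob A q = (\<Prod>i<card A. (real (card A) - real i) * w / (1 - real i * w))"
proof -
  have "ordered_prob zs q = (\<Prod>i<card A. w / (1 - real i * w))"
    if "zs \<in> permutations_of_set A" for zs
  proof -
    have zs: "set zs = A" "distinct zs" "length zs = card A"
      using that by (auto simp: permutations_of_set_def distinct_card)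
    have q: "q (zs ! i) = w" if "i < card A" for i
      using that zs assms(2) nth_mem[of i zs] by simp
    have "(\<Sum>j<i. q (zs ! j)) = real i * w" if "i < card A" for i
      using that q by simp
    then show ?thesis unfolding ordered_prob_def zs(3) using q by (intro prod.cong) auto
  qed
  then have "unordered_prob A q = fact (card A) * (\<Prod>i<card A. w / (1 - real i * w))"
    unfolding unordered_prob_altdef using assms(1) by simp
  also have "fact (card A) = (\<Prod>i<card A. real (card A) - real i)"
    by (simp add: fact_prod_rev atLeast0LessThan of_nat_diff cong: prod.cong_simp)
  finally show ?thesis by (simp add: prod.distrib[symmetric])
qed

text \<open>Factor \<open>i\<close> is \<open>1 - e i\<close>, where \<open>e i\<close> is the
  chance of leaving \<open>A\<close> at that draw. The product is at least one minus the sum of the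
  \<open>e i\<close>, and \<open>rest\<close> makes this sum at most 1/3.\<close>

lemma unordered_prob_uniform_ge:
  assumes "finite A" "\<forall>z\<in>A. q z = w" "w > 0" "real (card A) * w \<le> 1"
    and rest: "3 * real (card A) * (1 - real (card A) * w) \<le> w"
  shows "unordered_prob A q \<ge> 2 / 3"
proof -
  define m where "m = card A"
  define e where "e = (\<lambda>i. (1 - real m * w) / (1 - real i * w))"
  \<comment> \<open>After \<open>i < m\<close> draws from \<open>A\<close> at least one element of
    \<open>A\<close>, of mass \<open>w\<close>, is still left.\<close>
  have den: "w \<le> 1 - real i * w" if "i < m" for i
  proof -
    have "real (Suc i) * w \<le> real m * w"
      using that assms(3) by (intro mult_right_mono) auto
    then show ?thesis using assms(4) by (simp add: m_def algebra_simps)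
  qed
  have e: "0 \<le> e i" "e i \<le> (1 - real m * w) / w" "e i \<le> 1"
    and factor: "(real m - real i) * w / (1 - real i * w) = 1 - e i" if "i < m" for i
  proof -
    have "real i * w \<le> real m * w" using that assms(3) by (intro mult_right_mono) auto
    then show "e i \<le> 1" unfolding e_def using den[OF that] assms(3) by (simp add: divide_le_eq_1)
    show "0 \<le> e i" unfolding e_def using den[OF that] assms(3,4) by (simp add: m_def)
    show "e i \<le> (1 - real m * w) / w"
      unfolding e_def using den[OF that] assms(3,4) by (intro divide_left_mono) (auto simp: m_def)
    show "(real m - real i) * w / (1 - real i * w) = 1 - e i"
      unfolding e_def using den[OF that] assms(3) by (simp add: field_simps)
  qed
  have "(\<Sum>i<m. e i) \<le> (\<Sum>i<m. (1 - real m * w) / w)" using e by (intro sum_mono) auto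
  also have "\<dots> \<le> 1 / 3" using rest assms(3) by (simp add: m_def field_simps)
  finally have "2 / 3 \<le> 1 - (\<Sum>i<m. e i)" by simp
  also have "\<dots> \<le> (\<Prod>i<m. 1 - e i)" using e by (intro Weierstrass_prod_ineq) auto
  also have "\<dots> = unordered_prob A q"
    unfolding unordered_prob_uniform[OF assms(1,2)] using factor by (simp add: m_def)
  finally show ?thesis .
qed

section \<open>Teachers are matchings\<close>

text \<open>Turns the uniqueness condition of \<open>teacher\<close> into strict inequalities, the
  form in which both directions use it.\<close>

lemma unique_arg_max_iff:
  fixes f :: "'c \<Rightarrow> real"
  assumes "finite C" "c0 \<in> C"
  shows "{c. is_arg_max f (\<lambda>c. c \<in> C) c} = {c0} \<longleftrightarrow> (\<forall>c\<in>C - {c0}. f c < f c0)"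
proof
  assume max: "{c. is_arg_max f (\<lambda>c. c \<in> C) c} = {c0}"
  show "\<forall>c\<in>C - {c0}. f c < f c0"
  proof (rule ballI, rule ccontr)
    fix c assume c: "c \<in> C - {c0}" "\<not> f c < f c0"
    have "is_arg_max f (\<lambda>c. c \<in> C) c0" using max by auto
    then have "is_arg_max f (\<lambda>c. c \<in> C) c"
      using c unfolding is_arg_max_linorder by fastforce
    with max c show False by auto
  qed
next
  assume "\<forall>c\<in>C - {c0}. f c < f c0"
  with assms(2) show "{c. is_arg_max f (\<lambda>c. c \<in> C) c} = {c0}"
    unfolding is_arg_max_def by (auto dest: less_asym)
qed

lemma saturating_matching_consistency_graph:
  "saturating_matching (consistency_graph C Z sat) M \<longleftrightarrow>
     inj_on M C \<and> (\<forall>c\<in>C. M c \<subseteq> Z \<and> sat_all sat c (M c))"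
  unfolding saturating_matching_def consistency_graph_def by auto

lemma saturating_matching_remove_right:
  "saturating_matching (remove_right v G) M \<longleftrightarrow>
     saturating_matching G M \<and> (\<forall>l\<in>left G. M l \<noteq> v)"
  unfolding saturating_matching_def remove_right_def by auto

lemma left_remove_right [simp]: "left (remove_right v G) = left G"
  by (simp add: remove_right_def)

lemma left_consistency_graph [simp]: "left (consistency_graph C Z sat) = C"
  by (simp add: consistency_graph_def)

lemma teacher_less:
  assumes "finite C" "teacher C Z L T" "c0 \<in> C" "c \<in> C" "c \<noteq> c0"
  shows "prior L c * unordered_prob (T c0) (likelihood L c) <
         prior L c0 * unordered_prob (T c0) (likelihood L c0)"
  using assms
    unique_arg_max_iff[of C c0 "\<lambda>c. prior L c * unordered_prob (T c0) (likelihood L c)"]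
  unfolding teacher_def by auto

lemma ex_other_element:
  assumes "card C \<ge> 2"
  obtains c' where "c' \<in> C" "c' \<noteq> c"
proof -
  have "\<not> C \<subseteq> {c}" using assms card_mono[of "{c}" C] by auto
  then show ?thesis using that by auto
qed

lemma teacher_imp_matching:
  assumes "card C \<ge> 2" "finite Z" "MAP_learner C Z sat L" "teacher C Z L T"
  shows "saturating_matching (consistency_graph C Z sat) T"
  unfolding saturating_matching_consistency_graph
proof (intro conjI ballI inj_onI)
  have fin: "finite C" using assms(1) by (metis card.infinite not_numeral_le_zero)
  note less = teacher_less[OF fin assms(4)]
  \<comment> \<open>Distinct concepts with the same teaching set would each have to score strictly
    better than the other on it.\<close>
  show "c = c'" if "c \<in> C" "c' \<in> C" "T c = T c'" for c c'
    using less[of c c'] less[of c' c] that by fastforce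
  fix c assume c: "c \<in> C"
  then show TZ: "T c \<subseteq> Z" using assms(4) by (simp add: teacher_def)
  show "sat_all sat c (T c)"
    unfolding sat_all_def
  proof (rule ballI, rule ccontr)
    fix z assume z: "z \<in> T c" "\<not> sat c z"
    then have "likelihood L c z = 0" using assms(3) c TZ by (auto simp: MAP_learner_def)
    then have "unordered_prob (T c) (likelihood L c) = 0" using z by (intro unordered_prob_eq_0)
    \<comment> \<open>The competitor \<open>c'\<close> has a nonnegative score, which cannot lie
      strictly below the score 0 of \<open>c\<close>.\<close>
    moreover obtain c' where c': "c' \<in> C" "c' \<noteq> c" using ex_other_element[OF assms(1)] .
    moreover have "prior L c' * unordered_prob (T c) (likelihood L c') \<ge> 0"
      using assms(3) c'(1) TZ
      by (intro mult_nonneg_nonneg unordered_prob_nonneg[OF assms(2)])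
         (auto simp: MAP_learner_def less_imp_le)
    ultimately show False using less[OF c c'] by simp
  qed
qed

text \<open>Under uniform priors all concepts tie on the empty set, whose probability is always
  1.\<close>

lemma MLE_teacher_nonempty:
  assumes "card C \<ge> 2" "MLE_learner C Z sat L" "teacher C Z L T" "c \<in> C"
  shows "T c \<noteq> {}"
proof
  assume empty: "T c = {}"
  have fin: "finite C" using assms(1) by (metis card.infinite not_numeral_le_zero)
  obtain c' where c': "c' \<in> C" "c' \<noteq> c" using ex_other_element[OF assms(1)] .
  show False
    using teacher_less[OF fin assms(3,4) c'] assms(2,4) c' empty by (simp add: MLE_learner_def)
qed

section \<open>Matchings are teachers\<close>

definition matching_weight ::
    "'z set \<Rightarrow> ('c \<Rightarrow> 'z \<Rightarrow> bool) \<Rightarrow> real \<Rightarrow> ('c \<Rightarrow> 'z set) \<Rightarrow> 'c \<Rightarrow> 'z \<Rightarrow> real" where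
  "matching_weight Z sat t M c z =
     (if z \<in> Z \<and> sat c z then if z \<in> M c then t else 1 else 0)"

text \<open>The factor must exceed 1 to break the tie on the empty set, and stay below 4/3 so that
  its product with 1/2 remains below 2/3.\<close>

definition prior_weight :: "('c \<Rightarrow> 'z set) \<Rightarrow> 'c \<Rightarrow> real" where
  "prior_weight M c = (if M c = {} then 5 / 4 else 1)"

definition matching_learner ::
    "'c set \<Rightarrow> 'z set \<Rightarrow> ('c \<Rightarrow> 'z \<Rightarrow> bool) \<Rightarrow> real \<Rightarrow> ('c \<Rightarrow> 'z set) \<Rightarrow> ('c, 'z) learner" where
  "matching_learner C Z sat t M =
     \<lparr>prior = (\<lambda>c. prior_weight M c / sum (prior_weight M) C),
      likelihood = (\<lambda>c z. matching_weight Z sat t M c z / sum (matching_weight Z sat t M c) Z)\<rparr>"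

lemma prior_weight_pos: "prior_weight M c > 0"
  by (simp add: prior_weight_def)

text \<open>Collects the properties of labeled examples behind the construction. Since the sets of
  consistent examples are pairwise distinct and all of size \<open>n\<close>, none contains
  another.\<close>

locale regular_consistency =
  fixes C :: "'c set" and Z :: "'z set" and sat :: "'c \<Rightarrow> 'z \<Rightarrow> bool" and n :: nat
    and M :: "'c \<Rightarrow> 'z set"
  assumes finite_C: "finite C" and C_nonempty: "C \<noteq> {}" and finite_Z: "finite Z"
    and n_pos: "n > 0"
    and card_sat: "\<And>c. c \<in> C \<Longrightarrow> card {z\<in>Z. sat c z} = n"
    and inj_sat: "inj_on (\<lambda>c. {z\<in>Z. sat c z}) C"
    and matching: "saturating_matching (consistency_graph C Z sat) M"
begin

text \<open>The weight \<open>3 * n^2\<close> serves the last hypothesis of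
  \<open>unordered_prob_uniform_ge\<close>: for \<open>m = card (M c)\<close> and weight
  \<open>t\<close> it amounts to \<open>3 * m * (n - m) \<le> t\<close>.\<close>

abbreviation weight :: "'c \<Rightarrow> 'z \<Rightarrow> real" where
  "weight \<equiv> matching_weight Z sat (3 * real n ^ 2) M"

abbreviation lrn :: "('c, 'z) learner" where
  "lrn \<equiv> matching_learner C Z sat (3 * real n ^ 2) M"

lemma weight_ge_1: "3 * real n ^ 2 \<ge> 1"
  using n_pos one_le_power[of "real n" 2] by linarith

lemma M_subset: "c \<in> C \<Longrightarrow> M c \<subseteq> {z\<in>Z. sat c z}"
  and inj_M: "inj_on M C"
  using matching unfolding saturating_matching_consistency_graph sat_all_def by auto

lemma card_M_le: "c \<in> C \<Longrightarrow> card (M c) \<le> n"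
  using card_mono[OF _ M_subset[of c]] card_sat[of c] finite_Z by simp

lemma sum_weight:
  assumes "c \<in> C"
  shows "sum (weight c) Z = real (card (M c)) * (3 * real n ^ 2) + (real n - real (card (M c)))"
proof -
  let ?S = "{z\<in>Z. sat c z}"
  have fin: "finite ?S" using finite_Z by simp
  have "sum (weight c) Z = sum (weight c) ?S"
    using finite_Z by (intro sum.mono_neutral_right) (auto simp: matching_weight_def)
  also have "\<dots> = sum (weight c) (?S - M c) + sum (weight c) (M c)"
    using M_subset[OF assms] fin by (rule sum.subset_diff)
  also have "sum (weight c) (?S - M c) = (\<Sum>z\<in>?S - M c. 1)"
    by (intro sum.cong) (auto simp: matching_weight_def)
  also have "\<dots> = real n - real (card (M c))"
    using M_subset[OF assms] fin card_sat[OF assms] card_M_le[OF assms]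
    by (simp add: card_Diff_subset finite_subset of_nat_diff)
  also have "sum (weight c) (M c) = (\<Sum>z\<in>M c. 3 * real n ^ 2)"
    using M_subset[OF assms] by (intro sum.cong) (auto simp: matching_weight_def)
  finally show ?thesis by simp
qed

lemma sum_weight_pos:
  assumes "c \<in> C"
  shows "sum (weight c) Z > 0"
proof -
  have "real (card (M c)) \<le> real (card (M c)) * (3 * real n ^ 2)"
    using mult_left_mono[OF weight_ge_1, of "real (card (M c))"] by simp
  then show ?thesis unfolding sum_weight[OF assms] using n_pos by simp
qed

lemma likelihood_eq: "likelihood lrn c z = weight c z / sum (weight c) Z"
  by (simp add: matching_learner_def)

text \<open>Consistent examples outside \<open>M c\<close> keep a positive weight, so each support
  has size \<open>n\<close> and the bound \<open>N_plus\<close> excludes no set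
  \<open>M c\<close>.\<close>

lemma likelihood_pos_iff:
  assumes "c \<in> C"
  shows "likelihood lrn c z > 0 \<longleftrightarrow> z \<in> Z \<and> sat c z"
  using sum_weight_pos[OF assms] n_pos
  by (auto simp: likelihood_eq matching_weight_def zero_less_divide_iff)

lemma likelihood_nonneg: "c \<in> C \<Longrightarrow> likelihood lrn c z \<ge> 0"
  using sum_weight_pos[of c] by (auto simp: likelihood_eq matching_weight_def)

lemma sum_likelihood: "c \<in> C \<Longrightarrow> sum (likelihood lrn c) Z = 1"
  using sum_weight_pos[of c] by (simp add: likelihood_eq sum_divide_distrib[symmetric])

lemma sum_prior_weight_pos: "sum (prior_weight M) C > 0"
  using finite_C C_nonempty by (intro sum_pos prior_weight_pos)

lemma MAP_learner_lrn: "MAP_learner C Z sat lrn"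
  unfolding MAP_learner_def
proof (intro conjI ballI impI)
  show "(\<Sum>c\<in>C. prior lrn c) = 1"
    using sum_prior_weight_pos by (simp add: matching_learner_def sum_divide_distrib[symmetric])
  show "prior lrn c > 0" for c
    using sum_prior_weight_pos by (simp add: matching_learner_def prior_weight_pos)
  show "likelihood lrn c z = 0" if "\<not> sat c z" for c z
    using that by (simp add: likelihood_eq matching_weight_def)
qed (simp_all add: likelihood_nonneg sum_likelihood)

lemma MLE_learner_lrn:
  assumes "\<forall>c\<in>C. M c \<noteq> {}"
  shows "MLE_learner C Z sat lrn"
proof -
  have "prior_weight M c = 1" if "c \<in> C" for c
    using that assms by (simp add: prior_weight_def)
  then show ?thesis
    unfolding MLE_learner_def using MAP_learner_lrn by (simp add: matching_learner_def)
qed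

lemma N_plus_lrn: "N_plus C Z lrn = n"
proof -
  have "card {z\<in>Z. likelihood lrn c z > 0} = n" if "c \<in> C" for c
    using card_sat[OF that] likelihood_pos_iff[OF that] by (metis (no_types, lifting) Collect_cong)
  then have "(\<lambda>c. card {z\<in>Z. likelihood lrn c z > 0}) ` C = {n}"
    using C_nonempty by auto
  then show ?thesis by (simp add: N_plus_def)
qed

section \<open>Probabilities of a concept's own set and of the sets of others\<close>

lemma prob_own_ge:
  assumes "c \<in> C"
  shows "unordered_prob (M c) (likelihood lrn c) \<ge> 2 / 3"
proof -
  let ?S = "sum (weight c) Z" and ?m = "real (card (M c))"
  have S: "?S > 0" by (rule sum_weight_pos[OF assms])
  have m: "?m \<le> real n" using card_M_le[OF assms] by simp
  have rest: "1 - ?m * (3 * real n ^ 2 / ?S) = (real n - ?m) / ?S"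
    using S sum_weight[OF assms] by (simp add: field_simps)
  show ?thesis
  proof (rule unordered_prob_uniform_ge)
    show "finite (M c)" using M_subset[OF assms] finite_Z by (auto intro: finite_subset)
    show "\<forall>z\<in>M c. likelihood lrn c z = 3 * real n ^ 2 / ?S"
      using M_subset[OF assms] by (auto simp: likelihood_eq matching_weight_def)
    show "3 * real n ^ 2 / ?S > 0" using S n_pos by simp
    have "0 \<le> (real n - ?m) / ?S" using m S by simp
    then show "?m * (3 * real n ^ 2 / ?S) \<le> 1" using rest by linarith
    have "?m * (real n - ?m) \<le> real n * real n" using m by (intro mult_mono) auto
    then show "3 * ?m * (1 - ?m * (3 * real n ^ 2 / ?S)) \<le> 3 * real n ^ 2 / ?S"
      unfolding rest using S by (simp add: divide_right_mono power2_eq_square)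
  qed
qed

lemma prob_other_le:
  assumes c: "c \<in> C" "c0 \<in> C" "c \<noteq> c0" and ne: "M c0 \<noteq> {}"
  shows "unordered_prob (M c0) (likelihood lrn c) \<le> 1 / 2"
proof (cases "M c0 \<subseteq> {z\<in>Z. sat c z}")
  case False
  then obtain z where "z \<in> M c0" "\<not> sat c z" using M_subset[OF c(2)] by auto
  then show ?thesis
    by (subst unordered_prob_eq_0[of z]) (auto simp: likelihood_eq matching_weight_def)
next
  case True
  have neq: "M c \<noteq> M c0" using inj_M c by (auto dest: inj_onD)
  have "\<exists>z z'. z \<in> M c0 \<and> z' \<in> Z - M c0 \<and> weight c z \<le> weight c z'"
  proof (cases "M c \<subseteq> M c0")
    case False
    \<comment> \<open>Under \<open>c\<close> the elements of \<open>M c\<close> have the largest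
      weight, so any element of \<open>M c0\<close> can be exchanged for \<open>z'\<close>.\<close>
    then obtain z' where "z' \<in> M c - M c0" by auto
    moreover obtain z where "z \<in> M c0" using ne by auto
    ultimately show ?thesis
      using M_subset[OF c(1)] weight_ge_1 by (intro exI[of _ z] exI[of _ z']) (auto simp: matching_weight_def)
  next
    case sub: True
    \<comment> \<open>As a consistent example outside \<open>M c\<close>, \<open>z\<close> has
      weight 1, the smallest positive one, so it can be exchanged for any consistent
      \<open>z'\<close> outside \<open>M c0\<close>.\<close>
    then obtain z where z: "z \<in> M c0 - M c" using neq by auto
    have "M c0 \<noteq> {z\<in>Z. sat c z}"
    proof
      assume eq: "M c0 = {z\<in>Z. sat c z}"
      \<comment> \<open>Nested sets of the same size \<open>n\<close> are equal, which would force
        \<open>c = c0\<close>.\<close>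
      then have "{z\<in>Z. sat c z} \<subseteq> {z\<in>Z. sat c0 z}" using M_subset[OF c(2)] by simp
      then have "{z\<in>Z. sat c z} = {z\<in>Z. sat c0 z}"
        using card_sat c finite_Z by (intro card_subset_eq) auto
      then show False using inj_sat c by (auto dest: inj_onD)
    qed
    then obtain z' where "z' \<in> Z" "sat c z'" "z' \<notin> M c0" using True by auto
    then show ?thesis
      using z sub by (intro exI[of _ z] exI[of _ z']) (auto simp: matching_weight_def)
  qed
  then obtain z z' where zz: "z \<in> M c0" "z' \<in> Z - M c0" "weight c z \<le> weight c z'" by auto
  show ?thesis
  proof (rule unordered_prob_le_half[OF finite_Z _ sum_likelihood[OF c(1)] _ zz(1,2)])
    show "likelihood lrn c z \<le> likelihood lrn c z'"
      unfolding likelihood_eq using zz(3) sum_weight_pos[OF c(1)] by (intro divide_right_mono) auto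
  qed (use c True likelihood_nonneg in auto)
qed

lemma teacher_lrn: "teacher C Z lrn M"
  unfolding teacher_def N_plus_lrn
proof (intro ballI conjI)
  fix c0 assume c0: "c0 \<in> C"
  show "M c0 \<subseteq> Z" "card (M c0) \<le> n" using M_subset[OF c0] card_M_le[OF c0] by auto
  let ?P = "\<lambda>c. unordered_prob (M c0) (likelihood lrn c)"
  have less: "prior_weight M c * ?P c < prior_weight M c0 * ?P c0"
    if c: "c \<in> C" "c \<noteq> c0" for c
  proof (cases "M c0 = {}")
    case True
    \<comment> \<open>By injectivity only \<open>c0\<close> is matched to the empty set, so only its
      prior weight is 5/4, while both probabilities are 1.\<close>
    then have "M c \<noteq> {}" using inj_M c c0 by (metis inj_onD)
    then show ?thesis using True by (simp add: prior_weight_def)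
  next
    case False
    have "prior_weight M c * ?P c \<le> prior_weight M c * (1 / 2)"
      using prob_other_le[OF c(1) c0 c(2) False] prior_weight_pos[of M c]
      by (intro mult_left_mono) auto
    \<comment> \<open>Worst case: \<open>c\<close> is itself the concept with prior weight
      5/4.\<close>
    also have "\<dots> \<le> 5 / 8" by (simp add: prior_weight_def)
    also have "\<dots> < 2 / 3" by simp
    also have "\<dots> \<le> prior_weight M c0 * ?P c0"
      using prob_own_ge[OF c0] False by (simp add: prior_weight_def)
    finally show ?thesis .
  qed
  show "{c. is_arg_max (\<lambda>c. prior lrn c * ?P c) (\<lambda>c. c \<in> C) c} = {c0}"
    unfolding unique_arg_max_iff[OF finite_C c0]
    \<comment> \<open>The priors are the prior weights divided by one common positive constant,
      which preserves strict inequalities.\<close>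
    using less divide_strict_right_mono[OF _ sum_prior_weight_pos]
    by (auto simp: matching_learner_def)
qed

end

section \<open>Labeled examples\<close>

text \<open>The consistent examples form the graph of the indicator function of \<open>c\<close> on
  \<open>X\<close>, whose size does not depend on \<open>c\<close>.\<close>

lemma consistent_labeled_examples:
  "{z \<in> labeled_examples X. label_sat c z} = (\<lambda>x. (x, if x \<in> c then 1 else 0)) ` X"
  by (auto simp: labeled_examples_def label_sat_def split: if_splits)

lemma card_consistent_labeled_examples:
  "card {z \<in> labeled_examples X. label_sat c z} = card X"
  unfolding consistent_labeled_examples by (intro card_image inj_onI) auto

text \<open>A concept inside \<open>X\<close> is recovered as the set of points labeled 1.\<close>

lemma inj_on_consistent_labeled_examples:
  "inj_on (\<lambda>c. {z \<in> labeled_examples X. label_sat c z}) (Pow X)"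
proof (rule inj_on_inverseI)
  fix c assume "c \<in> Pow X"
  then show "{x. (x, 1) \<in> {z \<in> labeled_examples X. label_sat c z}} = c"
    by (auto simp: labeled_examples_def label_sat_def)
qed

theorem theorem5p1:
  fixes X :: "'a set" and C :: "'a set set"
  assumes "finite X" and "X \<noteq> {}" and "C \<subseteq> Pow X" and "card C \<ge> 2"
  shows "MAP_TD C (labeled_examples X) label_sat
           = SMN (consistency_graph C (labeled_examples X) label_sat) \<and>
         MLE_TD C (labeled_examples X) label_sat
           = SMN (remove_right {} (consistency_graph C (labeled_examples X) label_sat))"
proof -
  let ?Z = "labeled_examples X"
  let ?G = "consistency_graph C ?Z label_sat"
  have Z: "finite ?Z" using assms(1) by (simp add: labeled_examples_def)
  have C: "finite C" "C \<noteq> {}"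
    using assms(1,3,4) by (auto intro: finite_subset)
  have regular: "regular_consistency C ?Z label_sat (card X) M" if "saturating_matching ?G M" for M
    using that C Z assms(1,2) inj_on_subset[OF inj_on_consistent_labeled_examples assms(3)]
    by unfold_locales (auto simp: card_consistent_labeled_examples card_gt_0_iff)
  \<comment> \<open>The equivalence holds for each map \<open>T\<close> separately, so teachers and
    matchings realize the same set of orders, and the infima agree.\<close>
  have MAP: "(\<exists>L. MAP_learner C ?Z label_sat L \<and> teacher C ?Z L T) \<longleftrightarrow>
             saturating_matching ?G T" for T
    using teacher_imp_matching[OF assms(4) Z] regular_consistency.MAP_learner_lrn[OF regular]
      regular_consistency.teacher_lrn[OF regular] by blast
  have MLE: "(\<exists>L. MLE_learner C ?Z label_sat L \<and> teacher C ?Z L T) \<longleftrightarrow>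
             saturating_matching (remove_right {} ?G) T" for T
  proof
    assume "\<exists>L. MLE_learner C ?Z label_sat L \<and> teacher C ?Z L T"
    then show "saturating_matching (remove_right {} ?G) T"
      unfolding saturating_matching_remove_right
      using MAP[of T] MLE_teacher_nonempty[OF assms(4)]
      unfolding MLE_learner_def left_consistency_graph by blast
  next
    assume "saturating_matching (remove_right {} ?G) T"
    then have "saturating_matching ?G T" "\<forall>c\<in>C. T c \<noteq> {}"
      unfolding saturating_matching_remove_right by auto
    \<comment> \<open>With no concept matched to the empty set, every prior weight is 1, so the same
      learner has uniform priors.\<close>
    then show "\<exists>L. MLE_learner C ?Z label_sat L \<and> teacher C ?Z L T"
      using regular_consistency.MLE_learner_lrn[OF regular]
        regular_consistency.teacher_lrn[OF regular] by blast
  qed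
  have "{enat d |d. \<exists>L T. MAP_learner C ?Z label_sat L \<and> teacher C ?Z L T \<and> map_order C T = d} =
        {enat d |d. \<exists>M. saturating_matching ?G M \<and> map_order C M = d}"
    unfolding MAP[symmetric] by blast
  moreover have
    "{enat d |d. \<exists>L T. MLE_learner C ?Z label_sat L \<and> teacher C ?Z L T \<and> map_order C T = d} =
     {enat d |d. \<exists>M. saturating_matching (remove_right {} ?G) M \<and> map_order C M = d}"
    unfolding MLE[symmetric] by blast
  ultimately show ?thesis
    unfolding MAP_TD_def MLE_TD_def SMN_def by simp
qed

end
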